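(* Let $X$ be a non-Euclidean finite-dimensional real normed space and let $G=(V,E)$ be a finite simple graph with $|V|\geq 2$. If $G$ is globally rigid in $X$, then $G$ is 2-connected.
   Context: A normed space is non-Euclidean if its norm does not satisfy the parallelogram law. For a graph $G=(V,E)$, a placement is $p=(p_v)_{v\in V}\in X^V$ and $(G,p)$ is a framework. Frameworks $(G,p),(G,q)$ are equivalent if $\|p_v-p_w\|=\|q_v-q_w\|$ for all $vw\in E$, and congruent if $q_v=g(p_v)$ for all $v$ for some isometry $g$ of $X$. $(G,p)$ is globally rigid if every framework equivalent to it is congruent to it; $G$ is globally rigid in $X$ if the set of $p\in X^V$ with $(G,p)$ globally rigid has non-empty interior in $X^V$. *)

theory Defs
  imports "HOL-Analysis.Analysis" "Graph_Theory.Graph_Theory"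
begin

text \<open>
  A finite simple graph is a \<^locale>\<open>graph\<close> of the Graph\_Theory library: a finite, loop-free
  digraph without parallel arcs whose arc relation is symmetric. An undirected edge is
  a pair of opposite arcs, and the edge relation is \<^const>\<open>arcs_ends\<close>.

  The normed space is a whole type of class \<^class>\<open>real_normed_vector\<close>. The class
  \<^class>\<open>euclidean_space\<close> is not suitable, as it forces the norm to come from an inner product.
\<close>

definition parallelogram_law :: "('a::real_vector \<Rightarrow> real) \<Rightarrow> bool" where
  "parallelogram_law nrm \<longleftrightarrow>
     (\<forall>x y. (nrm (x + y))\<^sup>2 + (nrm (x - y))\<^sup>2 = 2 * (nrm x)\<^sup>2 + 2 * (nrm y)\<^sup>2)"

definition placements :: "('v, 'e) pre_digraph \<Rightarrow> ('v \<Rightarrow> 'a::real_normed_vector) set" where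
  "placements G = verts G \<rightarrow>\<^sub>E UNIV"

definition equivalent_frameworks ::
    "('v, 'e) pre_digraph \<Rightarrow> ('v \<Rightarrow> 'a::real_normed_vector) \<Rightarrow> ('v \<Rightarrow> 'a) \<Rightarrow> bool" where
  "equivalent_frameworks G p q \<longleftrightarrow>
     (\<forall>(v, w) \<in> arcs_ends G. norm (p v - p w) = norm (q v - q w))"

text \<open>Surjectivity is not required; in finite dimension it is automatic.\<close>

definition isometry :: "('a::real_normed_vector \<Rightarrow> 'a) \<Rightarrow> bool" where
  "isometry g \<longleftrightarrow> (\<forall>x y. dist (g x) (g y) = dist x y)"

definition congruent_frameworks ::
    "('v, 'e) pre_digraph \<Rightarrow> ('v \<Rightarrow> 'a::real_normed_vector) \<Rightarrow> ('v \<Rightarrow> 'a) \<Rightarrow> bool" where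
  "congruent_frameworks G p q \<longleftrightarrow> (\<exists>g. isometry g \<and> (\<forall>v \<in> verts G. q v = g (p v)))"

definition globally_rigid_framework ::
    "('v, 'e) pre_digraph \<Rightarrow> ('v \<Rightarrow> 'a::real_normed_vector) \<Rightarrow> bool" where
  "globally_rigid_framework G p \<longleftrightarrow>
     (\<forall>q \<in> placements G. equivalent_frameworks G p q \<longrightarrow> congruent_frameworks G p q)"

definition globally_rigid ::
    "'a::real_normed_vector itself \<Rightarrow> ('v, 'e) pre_digraph \<Rightarrow> bool" where
  "globally_rigid X G \<longleftrightarrow>
     product_topology (\<lambda>_. euclidean) (verts G) interior_of
       {p :: 'v \<Rightarrow> 'a. p \<in> placements G \<and> globally_rigid_framework G p} \<noteq> {}"

text \<open>
  The standard convention, requiring more than \<open>k\<close> vertices; in particular the complete graph on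
  two vertices is not 2-connected. The case \<open>S = {}\<close> includes connectedness of \<open>G\<close> itself.
\<close>

definition k_connected :: "nat \<Rightarrow> ('v, 'e) pre_digraph \<Rightarrow> bool" where
  "k_connected k G \<longleftrightarrow> card (verts G) > k \<and>
     (\<forall>S \<subseteq> verts G. card S < k \<longrightarrow> Digraph_Component.connected (G \<restriction> (verts G - S)))"

end

theory Submission
  imports Defs
begin

text \<open>
  If \<open>G\<close> is disconnected, one part can be translated far away without changing edge lengths. If
  \<open>v\<close> is a cut vertex, one part can be reflected in \<open>p v\<close>; global rigidity then gives
  \<open>norm (x + y) = norm (x - y)\<close> for \<open>x = p a - p v\<close>, \<open>y = p b - p v\<close> with \<open>a\<close>, \<open>b\<close> on different
  sides, for all \<open>p\<close> in an open set. Moving \<open>x\<close> and \<open>y\<close> by the same vector fixes the right-hand side,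
  so the norm would be locally constant at \<open>x + y\<close>, which is absurd.

  If \<open>G\<close> has two vertices, the isometries fixing 0 act transitively on spheres. By compactness they
  are surjective, so by the Mazur-Ulam theorem (with the reflection proof of Vaisala) they are
  linear. Among the bilinear forms dominating the squared norm, consider those that nearly minimise
  the supremum over all linear isometries \<open>g\<close> of the Hilbert-Schmidt norm in the frame \<open>g ` B\<close>, for a
  fixed basis \<open>B\<close>. By uniform convexity such a form is almost invariant, so by transitivity
  it is almost a multiple of the squared norm, and the parallelogram law follows.
\<close>

section \<open>Finite-dimensional normed spaces and the Mazur-Ulam theorem\<close>

text \<open>Equivalence of norms: on the compact unit sphere of the maximum norm on coefficients,
  the norm attains a minimum, positive by independence; scaling does the rest.\<close>

lemma coordinates_bounded:
  fixes B :: "'a::real_normed_vector set"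
  assumes fin: "finite B" and ind: "independent B"
  obtains C where "C > 0" "\<And>c b. b \<in> B \<Longrightarrow> \<bar>c b\<bar> \<le> C * norm (\<Sum>b\<in>B. c b *\<^sub>R b)"
proof (cases "B = {}")
  case True
  then show ?thesis using that[of 1] by auto
next
  case False
  define N where "N c = norm (\<Sum>b\<in>B. c b *\<^sub>R b)" for c :: "'a \<Rightarrow> real"
  \<comment> \<open>Coefficients are functions on all of \<open>'a\<close>, so that Tychonoff gives
    compactness; \<open>N\<close> reads only the values on \<open>B\<close>, where the maximum is
    1.\<close>
  define K where "K = (UNIV \<rightarrow>\<^sub>E {-1..1::real}) \<inter> (\<Union>b\<in>B. {c::'a \<Rightarrow> real. \<bar>c b\<bar> = 1})"
  have "compact (UNIV \<rightarrow>\<^sub>E {-1..1::real} :: ('a \<Rightarrow> real) set)"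
    using compactin_PiE[of "\<lambda>_::'a. euclidean" UNIV "\<lambda>_. {-1..1::real}"]
    by (simp add: euclidean_product_topology)
  moreover have "closed (\<Union>b\<in>B. {c::'a \<Rightarrow> real. \<bar>c b\<bar> = 1})"
    by (intro closed_UN fin ballI closed_Collect_eq continuous_intros) auto
  ultimately have K: "compact K"
    unfolding K_def by (rule compact_Int_closed)
  have cont: "continuous_on K N"
    unfolding N_def by (intro continuous_intros) (rule continuous_on_subset[OF continuous_on_product_coordinates subset_UNIV])
  have "(\<lambda>_. 1) \<in> K"
    using False by (auto simp: K_def)
  then obtain c0 where c0: "c0 \<in> K" and min: "\<And>c. c \<in> K \<Longrightarrow> N c0 \<le> N c"
    using continuous_attains_inf[OF K _ cont] by blast
  obtain b where "b \<in> B" "c0 b \<noteq> 0"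
    using c0 by (auto simp: K_def)
  then have "(\<Sum>b\<in>B. c0 b *\<^sub>R b) \<noteq> 0"
    using ind dependent_finite[OF fin] by blast
  then have pos: "N c0 > 0" by (simp add: N_def)
  show ?thesis
  proof
    show "1 / N c0 > 0" using pos by simp
    fix c :: "'a \<Rightarrow> real" and b assume b: "b \<in> B"
    define M where "M = Max ((\<lambda>b. \<bar>c b\<bar>) ` B)"
    have le: "\<bar>c b\<bar> \<le> M" if "b \<in> B" for b
      using that fin by (auto simp: M_def)
    have "M \<in> (\<lambda>b. \<bar>c b\<bar>) ` B"
      unfolding M_def using fin False by (intro Max_in) auto
    then obtain b1 where b1: "b1 \<in> B" "\<bar>c b1\<bar> = M" by auto
    have "M \<le> 1 / N c0 * N c"
    proof (cases "M = 0")
      case True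
      then show ?thesis using pos by (simp add: N_def)
    next
      case False
      then have M: "M > 0" using b1 by auto
      define c' where "c' b = (if b \<in> B then c b / M else 0)" for b
      have "c' \<in> K"
        using b1 M le by (auto simp: K_def c'_def abs_le_iff field_simps intro!: bexI[of _ b1])
          (smt (verit) le)+
      moreover have "N c' = N c / M"
      proof -
        have "(\<Sum>b\<in>B. c' b *\<^sub>R b) = (1 / M) *\<^sub>R (\<Sum>b\<in>B. c b *\<^sub>R b)"
          unfolding scaleR_sum_right by (intro sum.cong) (auto simp: c'_def)
        then show ?thesis using M by (simp add: N_def)
      qed
      ultimately have "N c0 \<le> N c / M" using min by force
      then show ?thesis using pos M by (simp add: field_simps)
    qed
    then show "\<bar>c b\<bar> \<le> 1 / N c0 * norm (\<Sum>b\<in>B. c b *\<^sub>R b)"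
      using le[OF b] by (simp add: N_def)
  qed
qed

text \<open>The coefficient bound places the ball inside the continuous image of a compact cube, and
  the ball is closed.\<close>

lemma compact_cball_finite_dim:
  fixes B :: "'a::real_normed_vector set"
  assumes fin: "finite B" and ind: "independent B" and span: "span B = UNIV"
  shows "compact (cball (0::'a) r)"
proof -
  obtain C where C: "C > 0" "\<And>c b. b \<in> B \<Longrightarrow> \<bar>c b\<bar> \<le> C * norm (\<Sum>b\<in>B. c b *\<^sub>R b)"
    using coordinates_bounded[OF fin ind] by blast
  define f where "f c = (\<Sum>b\<in>B. c b *\<^sub>R b)" for c :: "'a \<Rightarrow> real"
  let ?P = "UNIV \<rightarrow>\<^sub>E {-(C * r)..C * r} :: ('a \<Rightarrow> real) set"
  have "compact ?P"
    using compactin_PiE[of "\<lambda>_::'a. euclidean" UNIV "\<lambda>_. {-(C * r)..C * r}"]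
    by (simp add: euclidean_product_topology)
  moreover have "continuous_on ?P f"
    unfolding f_def by (intro continuous_intros) (rule continuous_on_subset[OF continuous_on_product_coordinates subset_UNIV])
  ultimately have cpt: "compact (f ` ?P)" by (rule compact_continuous_image[rotated])
  have "cball 0 r \<subseteq> f ` ?P"
  proof
    fix x :: 'a assume x: "x \<in> cball 0 r"
    then have r: "0 \<le> r" by (auto intro: order_trans[OF norm_ge_zero])
    have "x \<in> span B" using span by simp
    then obtain c where c: "x = f c"
      using span_finite[OF fin] by (auto simp: f_def)
    define c' where "c' b = (if b \<in> B then c b else 0)" for b
    have "f c' = x" using c by (auto simp: f_def c'_def intro: sum.cong)
    moreover have "\<bar>c' b\<bar> \<le> C * r" for b
    proof (cases "b \<in> B")
      case True
      have "\<bar>c b\<bar> \<le> C * norm x" using C(2)[OF True, of c] c by (simp add: f_def)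
      also have "\<dots> \<le> C * r" using x C(1) by simp
      finally show ?thesis using True by (simp add: c'_def)
    qed (use r C in \<open>simp add: c'_def\<close>)
    then have "c' \<in> ?P" by (force simp: abs_le_iff)
    ultimately show "x \<in> f ` ?P" by blast
  qed
  then have "cball 0 r = f ` ?P \<inter> cball 0 r" by blast
  then show ?thesis using compact_Int_closed[OF cpt closed_cball] by metis
qed

section \<open>Surjectivity of isometries\<close>

text \<open>A missed point has positive distance from the image of a ball, so its orbit would be a
  uniformly separated sequence in a compact ball.\<close>

lemma isometry_surj:
  fixes g :: "'a::real_normed_vector \<Rightarrow> 'a"
  assumes cpt: "\<And>r. compact (cball (0::'a) r)" and g: "isometry g"
  shows "surj g"
proof -
  \<comment> \<open>Fixing the origin makes \<open>h\<close> norm preserving, so it maps the ball of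
    radius \<open>norm y\<close> into itself.\<close>
  define h where "h x = g x - g 0" for x
  have dh: "dist (h x) (h y) = dist x y" for x y
    using g by (simp add: h_def isometry_def dist_norm)
  have nh: "norm (h x) = norm x" for x
    using dh[of x 0] by (simp add: h_def)
  have surj: "y \<in> range h" for y
  proof (rule ccontr)
    assume y: "y \<notin> range h"
    let ?K = "cball (0::'a) (norm y)"
    have "continuous_on ?K h"
      by (intro continuous_onI) (use dh in \<open>auto intro!: exI less_imp_le\<close>)
    then have "closed (h ` ?K)"
      using compact_continuous_image[OF _ cpt] compact_imp_closed by blast
    moreover have "y \<notin> h ` ?K" using y by auto
    ultimately obtain e where "e > 0" and "ball y e \<subseteq> - h ` ?K"
      by (metis ComplI open_Compl open_contains_ball)
    then have e: "e > 0" "\<And>z. z \<in> ?K \<Longrightarrow> e \<le> dist y (h z)"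
      by (auto simp: subset_iff not_less[symmetric])
    define s where "s n = (h ^^ n) y" for n
    have s: "s n \<in> ?K" for n
      by (induction n) (auto simp: s_def nh)
    \<comment> \<open>Cancelling \<open>m\<close> applications of \<open>h\<close> leaves the
      distance from \<open>y\<close> to \<open>h (s k)\<close>.\<close>
    have sep: "e \<le> dist (s m) (s (m + Suc k))" for m k
      by (induction m) (use e(2)[OF s[of k]] in \<open>auto simp: s_def dh\<close>)
    obtain l \<phi> where \<phi>: "strict_mono \<phi>" "(s \<circ> \<phi>) \<longlonglongrightarrow> l"
      using cpt[of "norm y"] s unfolding compact_def by meson
    then have "Cauchy (s \<circ> \<phi>)" by (intro LIMSEQ_imp_Cauchy)
    then obtain M where M: "\<And>m n. m \<ge> M \<Longrightarrow> n \<ge> M \<Longrightarrow> dist (s (\<phi> m)) (s (\<phi> n)) < e"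
      using e(1) unfolding Cauchy_def by (metis comp_apply)
    have "\<phi> M < \<phi> (Suc M)" using \<phi>(1) by (simp add: strict_mono_Suc_iff)
    then obtain k where "\<phi> (Suc M) = \<phi> M + Suc k" using less_iff_Suc_add by auto
    then show False using sep[of "\<phi> M" k] M[of M "Suc M"] by simp
  qed
  show ?thesis
  proof (rule surjI[of _ "\<lambda>y. SOME x. g x = y"])
    fix y
    obtain x where "y - g 0 = h x" using surj[of "y - g 0"] by blast
    then have "g x = y" by (simp add: h_def)
    then show "g (SOME x. g x = y) = y" by (rule someI)
  qed
qed

lemma isometry_inv:
  fixes g :: "'a::real_normed_vector \<Rightarrow> 'a"
  assumes "isometry g" "surj g"
  shows "isometry (inv g)"
  unfolding isometry_def by (metis assms isometry_def surj_f_inv_f)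

lemma isometry_imp_inj: "isometry g \<Longrightarrow> inj g"
  unfolding isometry_def inj_def by (metis dist_eq_0_iff)

section \<open>Midpoints and linearity\<close>

lemma isometry_reflection_conjugate:
  fixes f :: "'a::real_normed_vector \<Rightarrow> 'a"
  assumes f: "isometry f" "surj f"
  shows "isometry (\<lambda>x. u - inv f (w - f x))" and "surj (\<lambda>x. u - inv f (w - f x))"
proof -
  have "dist (u - inv f (w - f x)) (u - inv f (w - f y)) = dist x y" for x y
  proof -
    have "dist (u - inv f (w - f x)) (u - inv f (w - f y)) = dist (inv f (w - f x)) (inv f (w - f y))"
      by (simp add: dist_norm norm_minus_commute)
    also have "\<dots> = dist (w - f x) (w - f y)"
      using isometry_inv[OF f] by (simp add: isometry_def)
    also have "\<dots> = dist (f x) (f y)"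
      by (simp add: dist_norm norm_minus_commute)
    finally show ?thesis using f(1) by (simp add: isometry_def)
  qed
  then show "isometry (\<lambda>x. u - inv f (w - f x))" by (simp add: isometry_def)
  show "surj (\<lambda>x. u - inv f (w - f x))"
  proof (rule surjI)
    fix y show "u - inv f (w - f (inv f (w - f (u - y)))) = y"
      using f(2) isometry_imp_inj[OF f(1)] by (simp add: surj_f_inv_f)
  qed
qed

text \<open>From \<open>h\<close> one builds another isometry fixing \<open>a\<close> and
  \<open>b\<close> that moves the midpoint twice as far. Iteration would exceed the bound
  \<open>2 * norm (a - z)\<close> on such displacements unless the displacement is zero.\<close>

lemma isometry_fixes_midpoint:
  fixes h :: "'a::real_normed_vector \<Rightarrow> 'a"
  assumes "isometry h" "surj h" "h a = a" "h b = b"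
  shows "h (midpoint a b) = midpoint a b"
proof -
  define z where "z = midpoint a b"
  have z2: "a + b = z + z"
    by (simp add: z_def midpoint_def flip: scaleR_add_left)
  \<comment> \<open>The bound is stated for all \<open>h\<close>, since the induction passes from
    \<open>h\<close> to a different isometry.\<close>
  have bound: "2 ^ n * norm (h z - z) \<le> 2 * norm (a - z)"
    if "isometry h" "surj h" "h a = a" "h b = b" for n and h :: "'a \<Rightarrow> 'a"
    using that
  proof (induction n arbitrary: h)
    case 0
    have "norm (h z - z) \<le> norm (h z - h a) + norm (a - z)"
      using norm_triangle_ineq[of "h z - h a" "a - z"] 0 by simp
    also have "norm (h z - h a) = norm (a - z)"
      using 0(1) by (metis isometry_def dist_norm norm_minus_commute)
    finally show ?case by simp
  next
    case (Suc n)
    \<comment> \<open>The map sending \<open>x\<close> to \<open>a + b - x\<close> is the reflection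
      in the midpoint; it swaps \<open>a\<close> and \<open>b\<close>, so \<open>k\<close> fixes
      both.\<close>
    define k where "k x = a + b - inv h (a + b - h x)" for x
    have "isometry k" "surj k"
      unfolding k_def using isometry_reflection_conjugate[OF Suc.prems(1,2)] by auto
    moreover have "k a = a" "k b = b"
      using Suc.prems(3,4) inv_f_f[OF isometry_imp_inj[OF Suc.prems(1)], of a]
        inv_f_f[OF isometry_imp_inj[OF Suc.prems(1)], of b] by (simp_all add: k_def)
    ultimately have "2 ^ n * norm (k z - z) \<le> 2 * norm (a - z)" by (rule Suc.IH)
    moreover have "norm (k z - z) = 2 * norm (h z - z)"
    proof -
      have "norm (k z - z) = dist z (inv h (a + b - h z))"
        by (simp add: k_def dist_norm z2)
      also have "\<dots> = dist (h z) (h (inv h (a + b - h z)))"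
        using Suc.prems(1) by (simp add: isometry_def)
      also have "\<dots> = norm (h z - (a + b - h z))"
        using Suc.prems(2) by (simp add: surj_f_inv_f dist_norm)
      also have "h z - (a + b - h z) = 2 *\<^sub>R (h z - z)"
        by (simp add: z2 scaleR_2)
      finally show ?thesis by simp
    qed
    ultimately show ?case by simp
  qed
  have "norm (h z - z) = 0"
  proof (rule ccontr)
    assume "norm (h z - z) \<noteq> 0"
    then have "norm (h z - z) > 0" by simp
    then obtain n where n: "2 * norm (a - z) / norm (h z - z) < 2 ^ n"
      using real_arch_pow[of 2] by auto
    then have "2 * norm (a - z) < 2 ^ n * norm (h z - z)"
      using \<open>norm (h z - z) > 0\<close> by (simp add: field_simps)
    then show False using bound[OF assms, of n] by simp
  qed
  then show ?thesis by (simp add: z_def)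
qed

text \<open>Conjugate by \<open>f\<close> the reflection in the midpoint of \<open>f a\<close> and
  \<open>f b\<close>, then reflect in that of \<open>a\<close> and \<open>b\<close>: the result
  fixes \<open>a\<close> and \<open>b\<close>, hence their midpoint.\<close>

lemma isometry_midpoint:
  fixes f :: "'a::real_normed_vector \<Rightarrow> 'a"
  assumes f: "isometry f" "surj f"
  shows "f (midpoint a b) = midpoint (f a) (f b)"
proof -
  define k where "k x = a + b - inv f (f a + f b - f x)" for x
  have "isometry k" "surj k"
    unfolding k_def using isometry_reflection_conjugate[OF f] by auto
  moreover have "k a = a" "k b = b"
    using isometry_imp_inj[OF f(1)] by (simp_all add: k_def)
  ultimately have "k (midpoint a b) = midpoint a b" by (rule isometry_fixes_midpoint)
  moreover have "a + b - midpoint a b = midpoint a b"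
    by (simp add: midpoint_def diff_eq_eq flip: scaleR_add_left)
  ultimately have "inv f (f a + f b - f (midpoint a b)) = midpoint a b"
    unfolding k_def by (metis diff_diff_eq2 add_diff_cancel_left')
  then have "f a + f b = f (midpoint a b) + f (midpoint a b)"
    using f(2) by (metis diff_add_cancel surj_f_inv_f)
  then have "midpoint (f a) (f b) = (inverse 2) *\<^sub>R (f (midpoint a b) + f (midpoint a b))"
    by (simp add: midpoint_def)
  then show ?thesis by (simp add: flip: scaleR_2)
qed

text \<open>Preservation of midpoints and of 0 gives additivity; norm preservation bounds the defect
  of homogeneity on an interval, which forces it to vanish.\<close>

theorem Mazur_Ulam:
  fixes f :: "'a::real_normed_vector \<Rightarrow> 'a"
  assumes f: "isometry f" "surj f" "f 0 = 0"
  shows "linear f"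
proof -
  have half: "f ((1 / 2) *\<^sub>R x) = (1 / 2) *\<^sub>R f x" for x
    using isometry_midpoint[OF f(1,2), of x 0] f(3) by (simp add: midpoint_def)
  have add: "f (x + y) = f x + f y" for x y
  proof -
    have "(1 / 2) *\<^sub>R f (x + y) = (1 / 2) *\<^sub>R (f x + f y)"
      using isometry_midpoint[OF f(1,2), of x y] half[of "x + y"] by (simp add: midpoint_def)
    then show ?thesis by simp
  qed
  have norm_f: "norm (f x) = norm x" for x
    using f(1,3) unfolding isometry_def by (metis dist_0_norm dist_commute)
  have "f (r *\<^sub>R x) = r *\<^sub>R f x" for r x
  proof -
    \<comment> \<open>The additive function \<open>d\<close> vanishes at 1, so it is 1-periodic; being bounded on
      \<open>[0, 1]\<close>, it is bounded, hence zero.\<close>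
    define d where "d r = f (r *\<^sub>R x) - r *\<^sub>R f x" for r :: real
    have d_add: "d (r + s) = d r + d s" for r s
      by (simp add: d_def add scaleR_add_left)
    have d0: "d 0 = 0" by (simp add: d_def f(3))
    have d_minus: "d (- r) = - d r" for r
      using d_add[of r "-r"] d0 by (simp add: eq_neg_iff_add_eq_0 add.commute)
    have d_mult: "d (of_nat n * r) = of_nat n *\<^sub>R d r" for n r
      by (induction n) (simp_all add: d0 d_add scaleR_add_left distrib_right)
    have d_int: "d (of_int k) = 0" for k
    proof -
      have d_nat: "d (of_nat n) = 0" for n
        using d_mult[of n 1] by (simp add: d_def)
      then show ?thesis by (cases k) (simp_all add: d_minus del: of_nat_Suc)
    qed
    have bound: "norm (d r) \<le> 2 * norm x" for r
    proof -
      have "d r = d (frac r)"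
        using d_add[of "frac r" "of_int \<lfloor>r\<rfloor>"] d_int[of "\<lfloor>r\<rfloor>"] by (simp add: frac_def)
      also have "norm \<dots> \<le> norm (f (frac r *\<^sub>R x)) + norm (frac r *\<^sub>R f x)"
        unfolding d_def by (rule norm_triangle_ineq4)
      also have "\<dots> = frac r * (2 * norm x)"
        by (simp add: norm_f)
      also have "\<dots> \<le> 1 * (2 * norm x)"
        by (intro mult_right_mono) (auto intro: less_imp_le frac_lt_1)
      finally show ?thesis by simp
    qed
    have "norm (d r) = 0"
    proof (rule ccontr)
      assume "norm (d r) \<noteq> 0"
      then obtain n :: nat where "2 * norm x < of_nat n * norm (d r)"
        using reals_Archimedean3[of "norm (d r)"] by auto
      then show False using bound[of "of_nat n * r"] by (simp add: d_mult)
    qed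
    then show ?thesis by (simp add: d_def)
  qed
  then show ?thesis using add by (intro linearI)
qed

section \<open>Transitive linear isometries force the parallelogram law\<close>

text \<open>By Mazur-Ulam, these are the surjective isometries that fix the origin.\<close>

definition linear_isometries :: "('a::real_normed_vector \<Rightarrow> 'a) set" where
  "linear_isometries = {g. linear g \<and> surj g \<and> (\<forall>x. norm (g x) = norm x)}"

lemma linear_isometries_id: "id \<in> linear_isometries"
  by (simp add: linear_isometries_def linear_id)

lemma linear_isometries_comp:
  "g \<in> linear_isometries \<Longrightarrow> h \<in> linear_isometries \<Longrightarrow> g \<circ> h \<in> linear_isometries"
  by (simp add: linear_isometries_def linear_compose comp_surj del: o_apply) simp

text \<open>A multiple of the coordinate inner product works; the factor \<open>E\<close> comes from
  Cauchy-Schwarz. The upper bound later keeps the supremum over isometries finite.\<close>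

lemma ex_bilinear_ge_norm_bounded:
  fixes B :: "'a::real_normed_vector set"
  assumes fin: "finite B" and ind: "independent B" and span: "span B = UNIV"
  obtains \<beta> D where "bilinear \<beta>" "\<And>x::'a. (norm x)\<^sup>2 \<le> \<beta> x x"
    "\<And>x y. \<bar>\<beta> x y\<bar> \<le> D * norm x * norm y"
proof -
  obtain C where C: "C > 0" "\<And>c b. b \<in> B \<Longrightarrow> \<bar>c b\<bar> \<le> C * norm (\<Sum>b\<in>B. c b *\<^sub>R b)"
    using coordinates_bounded[OF fin ind] by blast
  define c where "c = representation B"
  have sum_c: "(\<Sum>b\<in>B. c x b *\<^sub>R b) = x" for x
    unfolding c_def using span by (intro sum_representation_eq ind fin) auto
  have c_le: "\<bar>c x b\<bar> \<le> C * norm x" if "b \<in> B" for x b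
    using C(2)[OF that, of "c x"] by (simp add: sum_c)
  have c_add: "c (x + y) b = c x b + c y b" and c_scale: "c (r *\<^sub>R x) b = r * c x b" for x y r b
    using span ind by (simp_all add: c_def representation_add representation_scale)
  define E where "E = (\<Sum>b\<in>B. (norm b)\<^sup>2)"
  have E: "E \<ge> 0" by (simp add: E_def sum_nonneg)
  define \<beta> where "\<beta> x y = E * (\<Sum>b\<in>B. c x b * c y b)" for x y
  show ?thesis
  proof
    show "bilinear \<beta>"
      unfolding bilinear_def \<beta>_def
      by (auto intro!: linearI simp: c_add c_scale algebra_simps sum.distrib sum_distrib_left)
  next
    fix x
    have "norm x \<le> (\<Sum>b\<in>B. norm (c x b *\<^sub>R b))"
      using norm_sum[of "\<lambda>b. c x b *\<^sub>R b" B] by (simp only: sum_c)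
    then have "(norm x)\<^sup>2 \<le> (\<Sum>b\<in>B. \<bar>c x b\<bar> * norm b)\<^sup>2"
      by (intro power_mono) simp_all
    also have "\<dots> \<le> (\<Sum>b\<in>B. \<bar>c x b\<bar>\<^sup>2) * E"
      unfolding E_def by (rule Cauchy_Schwarz_ineq_sum)
    finally show "(norm x)\<^sup>2 \<le> \<beta> x x" by (simp add: \<beta>_def power2_eq_square mult.commute)
  next
    fix x y
    have "\<bar>\<Sum>b\<in>B. c x b * c y b\<bar> \<le> (\<Sum>b\<in>B. \<bar>c x b\<bar> * \<bar>c y b\<bar>)"
      using sum_abs[of "\<lambda>b. c x b * c y b" B] by (simp add: abs_mult)
    also have "\<dots> \<le> (\<Sum>b\<in>B. (C * norm x) * (C * norm y))"
      using c_le C(1) by (intro sum_mono mult_mono) auto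
    finally have "\<bar>\<beta> x y\<bar> \<le> E * (\<Sum>b\<in>B. (C * norm x) * (C * norm y))"
      using E by (simp add: \<beta>_def abs_mult mult_left_mono)
    then show "\<bar>\<beta> x y\<bar> \<le> (E * card B * C\<^sup>2) * norm x * norm y"
      by (simp add: power2_eq_square algebra_simps)
  qed
qed

lemma bilinear_bound_from_frame:
  fixes B :: "'a::real_normed_vector set" and \<delta> :: "'a \<Rightarrow> 'a \<Rightarrow> real" and C s :: real
  assumes fin: "finite B" and span: "span B = UNIV"
    and C: "C \<ge> 0" "\<And>c b. b \<in> B \<Longrightarrow> \<bar>c b\<bar> \<le> C * norm (\<Sum>b\<in>B. c b *\<^sub>R b)"
    and h: "h \<in> linear_isometries" and bil: "bilinear \<delta>"
    and d: "\<And>b c. b \<in> B \<Longrightarrow> c \<in> B \<Longrightarrow> \<bar>\<delta> (h b) (h c)\<bar> \<le> s" and s: "s \<ge> 0"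
  shows "\<bar>\<delta> x x\<bar> \<le> (card B)\<^sup>2 * C\<^sup>2 * s * (norm x)\<^sup>2"
proof -
  have lin: "linear h" and surj: "surj h" and iso: "\<And>x. norm (h x) = norm x"
    using h by (auto simp: linear_isometries_def)
  obtain z where z: "x = h z" using surj by blast
  have "z \<in> span B" using span by simp
  then obtain c where c: "z = (\<Sum>b\<in>B. c b *\<^sub>R b)"
    using span_finite[OF fin] by auto
  have c_le: "\<bar>c b\<bar> \<le> C * norm x" if "b \<in> B" for b
    using C(2)[OF that, of c] by (simp add: z iso flip: c)
  have x: "x = (\<Sum>b\<in>B. c b *\<^sub>R h b)"
    using lin by (simp add: z c linear_sum linear_scale)
  have "\<delta> x x = (\<Sum>(i,j)\<in>B \<times> B. \<delta> (c i *\<^sub>R h i) (c j *\<^sub>R h j))"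
    unfolding x by (rule bilinear_sum[OF bil])
  also have "\<dots> = (\<Sum>(i,j)\<in>B \<times> B. c i * c j * \<delta> (h i) (h j))"
    using bil by (simp add: bilinear_lmul bilinear_rmul mult.assoc)
  finally have "\<bar>\<delta> x x\<bar> \<le> (\<Sum>p\<in>B \<times> B. \<bar>case p of (i, j) \<Rightarrow> c i * c j * \<delta> (h i) (h j)\<bar>)"
    by (simp only: sum_abs)
  also have "\<dots> \<le> (\<Sum>p\<in>B \<times> B. (C * norm x) * (C * norm x) * s)"
  proof (rule sum_mono)
    fix p assume "p \<in> B \<times> B"
    then obtain i j where p: "p = (i, j)" "i \<in> B" "j \<in> B" by auto
    have "\<bar>c i\<bar> * \<bar>c j\<bar> * \<bar>\<delta> (h i) (h j)\<bar> \<le> (C * norm x) * (C * norm x) * s"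
      using p c_le d C(1) by (intro mult_mono) auto
    then show "\<bar>case p of (i, j) \<Rightarrow> c i * c j * \<delta> (h i) (h j)\<bar> \<le> (C * norm x) * (C * norm x) * s"
      by (simp add: p abs_mult)
  qed
  also have "\<dots> = (card B)\<^sup>2 * C\<^sup>2 * s * (norm x)\<^sup>2"
    by (simp add: card_cartesian_product power2_eq_square algebra_simps)
  finally show ?thesis .
qed

lemma ex_almost_invariant_form:
  fixes B :: "'a::real_normed_vector set"
  assumes fin: "finite B" and ind: "independent B" and span: "span B = UNIV" and e: "e > 0"
  obtains \<beta> :: "'a \<Rightarrow> 'a \<Rightarrow> real" where "bilinear \<beta>" "\<And>x. (norm x)\<^sup>2 \<le> \<beta> x x"
    "\<And>g x. g \<in> linear_isometries \<Longrightarrow> \<bar>\<beta> (g x) (g x) - \<beta> x x\<bar> \<le> e * (norm x)\<^sup>2"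
proof -
  obtain C where C: "C > 0" "\<And>c b. b \<in> B \<Longrightarrow> \<bar>c b\<bar> \<le> C * norm (\<Sum>b\<in>B. c b *\<^sub>R b)"
    using coordinates_bounded[OF fin ind] by blast
  define S :: "('a \<Rightarrow> 'a) \<Rightarrow> ('a \<Rightarrow> 'a \<Rightarrow> real) \<Rightarrow> real"
    where "S g \<beta> = (\<Sum>p\<in>B \<times> B. (\<beta> (g (fst p)) (g (snd p)))\<^sup>2)" for g \<beta>
  define P :: "('a \<Rightarrow> 'a \<Rightarrow> real) \<Rightarrow> bool"
    where "P \<beta> \<longleftrightarrow> bilinear \<beta> \<and> (\<forall>x. (norm x)\<^sup>2 \<le> \<beta> x x)" for \<beta>
  \<comment> \<open>Collecting upper bounds instead of suprema makes \<open>Inf R\<close> the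
    minimax value even if some forms have infinite supremum.\<close>
  define R where "R = {r. \<exists>\<beta>. P \<beta> \<and> (\<forall>g\<in>linear_isometries. S g \<beta> \<le> r)}"
  have "R \<noteq> {}"
  proof -
    obtain \<beta> D where \<beta>: "bilinear \<beta>" "\<And>x::'a. (norm x)\<^sup>2 \<le> \<beta> x x"
      and D: "\<And>x y. \<bar>\<beta> x y\<bar> \<le> D * norm x * norm y"
      using ex_bilinear_ge_norm_bounded[OF fin ind span] by blast
    have "S g \<beta> \<le> (\<Sum>p\<in>B \<times> B. (D * norm (fst p) * norm (snd p))\<^sup>2)"
      if "g \<in> linear_isometries" for g
      unfolding S_def
    proof (rule sum_mono)
      fix p
      have "\<bar>\<beta> (g (fst p)) (g (snd p))\<bar> \<le> D * norm (fst p) * norm (snd p)"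
        using D[of "g (fst p)" "g (snd p)"] that by (simp add: linear_isometries_def)
      from power_mono[OF this abs_ge_zero, of 2]
      show "(\<beta> (g (fst p)) (g (snd p)))\<^sup>2 \<le> (D * norm (fst p) * norm (snd p))\<^sup>2"
        by simp
    qed
    then show ?thesis using \<beta> unfolding R_def P_def by blast
  qed
  have "bdd_below R"
  proof (rule bdd_belowI)
    fix r assume "r \<in> R"
    then obtain \<beta> where "S id \<beta> \<le> r" using linear_isometries_id unfolding R_def by blast
    moreover have "0 \<le> S id \<beta>" unfolding S_def by (intro sum_nonneg) simp
    ultimately show "0 \<le> r" by simp
  qed
  define m where "m = Inf R"
  \<comment> \<open>Chosen so that the frame bound is at most \<open>e\<close>; adding 1 covers an
    empty basis. The slack \<open>s\<^sup>2 / 8\<close> on both sides of \<open>m\<close> adds up to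
    \<open>s\<^sup>2\<close> in the parallelogram identity.\<close>
  define s where "s = e / ((card B)\<^sup>2 * C\<^sup>2 + 1)"
  have den: "(card B)\<^sup>2 * C\<^sup>2 + 1 > 0" by (rule add_nonneg_pos) simp_all
  then have s: "s > 0" using e by (simp add: s_def)
  obtain r where r: "r \<in> R" "r < m + s\<^sup>2 / 8"
    using cInf_lessD[OF \<open>R \<noteq> {}\<close>, of "m + s\<^sup>2 / 8"] s by (auto simp: m_def)
  obtain \<beta> where \<beta>: "P \<beta>" and S\<beta>: "\<And>g. g \<in> linear_isometries \<Longrightarrow> S g \<beta> \<le> r"
    using r(1) unfolding R_def by blast
  have bil: "bilinear \<beta>" using \<beta> by (simp add: P_def)
  show ?thesis
  proof
    show "bilinear \<beta>" by (rule bil)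
    show "(norm x)\<^sup>2 \<le> \<beta> x x" for x using \<beta> by (simp add: P_def)
    fix g :: "'a \<Rightarrow> 'a" and x assume g: "g \<in> linear_isometries"
    then have lin: "linear g" and iso: "\<And>x. norm (g x) = norm x"
      by (auto simp: linear_isometries_def)
    define \<gamma> where "\<gamma> x y = \<beta> (g x) (g y)" for x y
    define \<mu> where "\<mu> x y = (\<beta> x y + \<gamma> x y) / 2" for x y
    define \<delta> where "\<delta> x y = \<gamma> x y - \<beta> x y" for x y
    have bil\<gamma>: "bilinear \<gamma>"
      unfolding bilinear_def \<gamma>_def
      by (auto intro!: linearI simp: linear_add[OF lin] linear_scale[OF lin]
          bilinear_ladd[OF bil] bilinear_radd[OF bil] bilinear_lmul[OF bil] bilinear_rmul[OF bil])
    have bil\<mu>: "bilinear \<mu>" and bil\<delta>: "bilinear \<delta>"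
      unfolding bilinear_def \<mu>_def \<delta>_def
      by (auto intro!: linearI simp: bilinear_ladd[OF bil] bilinear_radd[OF bil]
          bilinear_lmul[OF bil] bilinear_rmul[OF bil] bilinear_ladd[OF bil\<gamma>]
          bilinear_radd[OF bil\<gamma>] bilinear_lmul[OF bil\<gamma>] bilinear_rmul[OF bil\<gamma>] field_simps)
    have ge: "(norm x)\<^sup>2 \<le> \<beta> x x" "(norm x)\<^sup>2 \<le> \<gamma> x x" for x
      using \<beta> iso[of x] unfolding P_def \<gamma>_def by metis+
    have "P \<mu>" unfolding P_def
    proof (intro conjI allI bil\<mu>)
      fix x show "(norm x)\<^sup>2 \<le> \<mu> x x" using ge[of x] by (simp add: \<mu>_def)
    qed
    \<comment> \<open>Below the infimum there is no upper bound for the admissible form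
      \<open>\<mu>\<close>, so some frame exceeds this value.\<close>
    moreover have "m - s\<^sup>2 / 8 \<notin> R"
    proof
      assume "m - s\<^sup>2 / 8 \<in> R"
      then have "m \<le> m - s\<^sup>2 / 8" unfolding m_def by (rule cInf_lower) fact
      then show False using s by simp
    qed
    ultimately obtain h where h: "h \<in> linear_isometries" and Sh: "S h \<mu> > m - s\<^sup>2 / 8"
      unfolding R_def by fastforce
    \<comment> \<open>Pulling a form back by \<open>g\<close> only changes the frame, so
      \<open>r\<close> bounds \<open>\<gamma>\<close> as well.\<close>
    have "S h \<gamma> = S (g \<circ> h) \<beta>" by (simp add: S_def \<gamma>_def)
    then have S\<gamma>: "S h \<gamma> \<le> r" using S\<beta>[OF linear_isometries_comp[OF g h]] by simp
    \<comment> \<open>The parallelogram identity for the Hilbert-Schmidt norm in the frame \<open>h ` B\<close>: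
      nearly minimal forms are close to each other.\<close>
    have "S h \<delta> = (\<Sum>p\<in>B \<times> B. 2 * (\<beta> (h (fst p)) (h (snd p)))\<^sup>2 + 2 * (\<gamma> (h (fst p)) (h (snd p)))\<^sup>2
        - 4 * (\<mu> (h (fst p)) (h (snd p)))\<^sup>2)"
      unfolding S_def \<delta>_def \<mu>_def by (intro sum.cong refl) (simp add: power2_eq_square field_simps)
    also have "\<dots> = 2 * S h \<beta> + 2 * S h \<gamma> - 4 * S h \<mu>"
      unfolding S_def by (simp add: sum.distrib sum_subtractf sum_distrib_left)
    also have "\<dots> \<le> s\<^sup>2"
      using S\<beta>[OF h] S\<gamma> Sh r(2) by simp
    finally have S\<delta>: "S h \<delta> \<le> s\<^sup>2" .
    have "\<bar>\<delta> (h b) (h c)\<bar> \<le> s" if "b \<in> B" "c \<in> B" for b c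
    proof -
      have "(\<delta> (h b) (h c))\<^sup>2 \<le> S h \<delta>"
        unfolding S_def using member_le_sum[of "(b, c)" "B \<times> B" "\<lambda>p. (\<delta> (h (fst p)) (h (snd p)))\<^sup>2"]
        that fin by simp
      then show ?thesis using S\<delta> s abs_le_square_iff[of "\<delta> (h b) (h c)" s] by simp
    qed
    then have "\<bar>\<delta> x x\<bar> \<le> (card B)\<^sup>2 * C\<^sup>2 * s * (norm x)\<^sup>2"
      using bilinear_bound_from_frame[OF fin span less_imp_le[OF C(1)] C(2) h bil\<delta>] s by force
    also have "\<dots> \<le> e * (norm x)\<^sup>2"
    proof (rule mult_right_mono)
      show "(card B)\<^sup>2 * C\<^sup>2 * s \<le> e"
        using den e by (simp add: s_def field_simps)
    qed simp
    finally show "\<bar>\<beta> (g x) (g x) - \<beta> x x\<bar> \<le> e * (norm x)\<^sup>2"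
      by (simp add: \<delta>_def \<gamma>_def)
  qed
qed

text \<open>An almost invariant form is transported from \<open>u\<close> to every vector by
  transitivity and scaling, so its exact parallelogram identity passes to the squared norm with
  error \<open>e * t\<close>.\<close>

lemma transitive_imp_parallelogram_law:
  fixes B :: "'a::real_normed_vector set" and u :: 'a
  assumes fin: "finite B" and ind: "independent B" and span: "span B = UNIV"
    and u: "u \<noteq> 0"
    and trans: "\<And>y. norm y = norm u \<Longrightarrow> \<exists>g\<in>linear_isometries. g u = y"
  shows "parallelogram_law (norm :: 'a \<Rightarrow> real)"
  unfolding parallelogram_law_def
proof (intro allI)
  fix x y :: 'a
  define d where "d = (norm (x + y))\<^sup>2 + (norm (x - y))\<^sup>2 - 2 * (norm x)\<^sup>2 - 2 * (norm y)\<^sup>2"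
  define t where "t = (norm (x + y))\<^sup>2 + (norm (x - y))\<^sup>2 + 2 * (norm x)\<^sup>2 + 2 * (norm y)\<^sup>2"
  have t: "t \<ge> 0" by (simp add: t_def)
  have bound: "\<bar>d\<bar> \<le> e * t" if e: "e > 0" for e
  proof -
    obtain \<beta> :: "'a \<Rightarrow> 'a \<Rightarrow> real" where \<beta>: "bilinear \<beta>" "\<And>x. (norm x)\<^sup>2 \<le> \<beta> x x"
      "\<And>g x. g \<in> linear_isometries \<Longrightarrow> \<bar>\<beta> (g x) (g x) - \<beta> x x\<bar> \<le> e * (norm x)\<^sup>2"
      using ex_almost_invariant_form[OF fin ind span e] by blast
    define c where "c = \<beta> u u / (norm u)\<^sup>2"
    \<comment> \<open>Since \<open>\<beta>\<close> and \<open>c\<close> vary with \<open>e\<close>,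
      this lower bound is what allows cancelling \<open>c\<close> from the estimate.\<close>
    have c: "c \<ge> 1" using \<beta>(2)[of u] u by (simp add: c_def)
    have near: "\<bar>\<beta> z z - c * (norm z)\<^sup>2\<bar> \<le> e * (norm z)\<^sup>2" for z
    proof (cases "z = 0")
      case True
      then show ?thesis using \<beta>(1) by (simp add: bilinear_lzero)
    next
      case False
      define k where "k = norm z / norm u"
      have k: "k > 0" using False u by (simp add: k_def)
      have "norm ((1 / k) *\<^sub>R z) = norm u" using False u by (simp add: k_def)
      then obtain g where g: "g \<in> linear_isometries" "g u = (1 / k) *\<^sub>R z" using trans by blast
      have z: "z = k *\<^sub>R g u" using g k by simp
      have nz: "(norm z)\<^sup>2 = k\<^sup>2 * (norm u)\<^sup>2" using u by (simp add: k_def field_simps)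
      have "\<beta> z z = k\<^sup>2 * \<beta> (g u) (g u)"
        unfolding z using \<beta>(1) by (simp add: bilinear_lmul bilinear_rmul power2_eq_square mult.assoc)
      moreover have "c * (norm z)\<^sup>2 = k\<^sup>2 * \<beta> u u"
        using u by (simp add: nz c_def)
      ultimately have "\<bar>\<beta> z z - c * (norm z)\<^sup>2\<bar> = k\<^sup>2 * \<bar>\<beta> (g u) (g u) - \<beta> u u\<bar>"
        by (simp add: abs_mult flip: right_diff_distrib)
      also have "\<dots> \<le> k\<^sup>2 * (e * (norm u)\<^sup>2)"
        using \<beta>(3)[OF g(1)] by (intro mult_left_mono) auto
      finally show ?thesis by (simp add: nz algebra_simps)
    qed
    have "\<beta> (x + y) (x + y) + \<beta> (x - y) (x - y) = 2 * \<beta> x x + 2 * \<beta> y y"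
      using \<beta>(1) by (simp add: bilinear_ladd bilinear_radd bilinear_lsub bilinear_rsub)
    then have "\<bar>c * (norm (x + y))\<^sup>2 + c * (norm (x - y))\<^sup>2 - 2 * (c * (norm x)\<^sup>2) - 2 * (c * (norm y)\<^sup>2)\<bar>
        \<le> e * (norm (x + y))\<^sup>2 + e * (norm (x - y))\<^sup>2 + 2 * (e * (norm x)\<^sup>2) + 2 * (e * (norm y)\<^sup>2)"
      using near[of "x + y"] near[of "x - y"] near[of x] near[of y] by linarith
    then have "\<bar>c * d\<bar> \<le> e * t"
      by (simp add: d_def t_def algebra_simps)
    moreover have "\<bar>d\<bar> \<le> \<bar>c * d\<bar>"
      using c mult_right_mono[of 1 c "\<bar>d\<bar>"] by (simp add: abs_mult)
    ultimately show ?thesis by linarith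
  qed
  have "\<bar>d\<bar> \<le> 0"
  proof (rule field_le_epsilon)
    fix e :: real assume e: "e > 0"
    have "\<bar>d\<bar> \<le> e / (t + 1) * t" using bound[of "e / (t + 1)"] e t by simp
    also have "\<dots> \<le> e" using e t by (simp add: field_simps)
    finally show "\<bar>d\<bar> \<le> 0 + e" by simp
  qed
  then show "(norm (x + y))\<^sup>2 + (norm (x - y))\<^sup>2 = 2 * (norm x)\<^sup>2 + 2 * (norm y)\<^sup>2"
    by (simp add: d_def)
qed

section \<open>Global rigidity\<close>

lemma globally_rigidE:
  fixes G :: "('v, 'e) pre_digraph"
  assumes fin: "finite (verts G)" and rigid: "globally_rigid TYPE('a::real_normed_vector) G"
  obtains p :: "'v \<Rightarrow> 'a::real_normed_vector" and e where "p \<in> placements G" "e > 0"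
    "\<And>q. q \<in> placements G \<Longrightarrow> (\<And>v. v \<in> verts G \<Longrightarrow> dist (p v) (q v) < e) \<Longrightarrow>
      globally_rigid_framework G q"
proof -
  obtain T and p :: "'v \<Rightarrow> 'a" where T: "openin (product_topology (\<lambda>_. euclidean) (verts G)) T"
    "p \<in> T" "T \<subseteq> {p. p \<in> placements G \<and> globally_rigid_framework G p}"
    using rigid unfolding globally_rigid_def interior_of_def by blast
  obtain U where U: "\<And>v. v \<in> verts G \<Longrightarrow> open (U v)" "p \<in> Pi\<^sub>E (verts G) U" "Pi\<^sub>E (verts G) U \<subseteq> T"
    using T(1,2) unfolding openin_product_topology_alt by (metis open_openin)
  have "\<exists>e>0. ball (p v) e \<subseteq> U v" if "v \<in> verts G" for v
    using U(1)[OF that] U(2) that by (meson PiE_mem open_contains_ball)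
  then obtain r where r: "\<And>v. v \<in> verts G \<Longrightarrow> r v > 0 \<and> ball (p v) (r v) \<subseteq> U v"
    by metis
  \<comment> \<open>Finitely many radii give a common one; the inserted 1 keeps \<open>Min\<close>
    defined when there are no vertices.\<close>
  define e where "e = Min (insert 1 (r ` verts G))"
  have e: "e > 0" "\<And>v. v \<in> verts G \<Longrightarrow> e \<le> r v"
    using fin r by (auto simp: e_def)
  show ?thesis
  proof
    show "p \<in> placements G" using T by blast
    show "e > 0" by (rule e)
    fix q assume q: "q \<in> placements G" "\<And>v. v \<in> verts G \<Longrightarrow> dist (p v) (q v) < e"
    have "q v \<in> U v" if "v \<in> verts G" for v
      using q(2)[OF that] e(2)[OF that] r[OF that] by (auto simp: subset_iff)
    then have "q \<in> T" using q(1) U(3) by (auto simp: placements_def PiE_iff subset_iff)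
    then show "globally_rigid_framework G q" using T by blast
  qed
qed

text \<open>Allows a comparison map \<open>f\<close> with arbitrary values off the vertices; its
  restriction is the extensional function that \<open>placements\<close> demands.\<close>

lemma globally_rigid_frameworkD:
  assumes "globally_rigid_framework G p"
    and "\<And>v w. (v, w) \<in> arcs_ends G \<Longrightarrow> v \<in> verts G \<Longrightarrow> w \<in> verts G \<Longrightarrow>
      norm (p v - p w) = norm (f v - f w)"
    and "wf_digraph G"
  obtains g where "isometry g" "\<And>v. v \<in> verts G \<Longrightarrow> f v = g (p v)"
proof -
  let ?q = "restrict f (verts G)"
  have "?q \<in> placements G" by (simp add: placements_def)
  moreover have "equivalent_frameworks G p ?q"
    unfolding equivalent_frameworks_def
    using assms(2) wf_digraph.adj_in_verts[OF assms(3)] by fastforce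
  ultimately show ?thesis
    using assms(1) that unfolding globally_rigid_framework_def congruent_frameworks_def by fastforce
qed

lemma globally_rigid_framework_dist:
  fixes p f :: "'v \<Rightarrow> 'a::real_normed_vector"
  assumes "globally_rigid_framework G p"
    and "\<And>v w. (v, w) \<in> arcs_ends G \<Longrightarrow> v \<in> verts G \<Longrightarrow> w \<in> verts G \<Longrightarrow>
      norm (p v - p w) = norm (f v - f w)"
    and "wf_digraph G" and "a \<in> verts G" "b \<in> verts G"
  shows "norm (f a - f b) = norm (p a - p b)"
proof -
  obtain g where "isometry g" "\<And>v. v \<in> verts G \<Longrightarrow> f v = g (p v)"
    using globally_rigid_frameworkD[OF assms(1-3)] by blast
  then show ?thesis using assms(4,5) by (simp add: isometry_def dist_norm)
qed

section \<open>Disconnected graphs and cut vertices\<close>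

text \<open>\<open>A\<close> is the component of \<open>a\<close>. Connectedness in the library
  includes being nonempty, hence the condition on \<open>W\<close>.\<close>

lemma not_connected_induce_subgraphE:
  assumes "\<not> Digraph_Component.connected (G \<restriction> W)" and "W \<noteq> {}"
  obtains A a b where "A \<subseteq> W" "a \<in> A" "b \<in> W" "b \<notin> A"
    "\<And>x y. (x, y) \<in> arcs_ends G \<Longrightarrow> x \<in> W \<Longrightarrow> y \<in> W \<Longrightarrow> x \<in> A \<longleftrightarrow> y \<in> A"
proof -
  let ?R = "rtrancl_on W ((arcs_ends (G \<restriction> W))\<^sup>s)"
  obtain a b where ab: "a \<in> W" "b \<in> W" "(a, b) \<notin> ?R"
    using assms by (auto simp: connected_conv)
  show ?thesis
  proof
    show "{x \<in> W. (a, x) \<in> ?R} \<subseteq> W" "a \<in> {x \<in> W. (a, x) \<in> ?R}" "b \<in> W" "b \<notin> {x \<in> W. (a, x) \<in> ?R}"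
      using ab by auto
    fix x y assume xy: "(x, y) \<in> arcs_ends G" "x \<in> W" "y \<in> W"
    then have "(x, y) \<in> arcs_ends (G \<restriction> W)"
      by (auto simp: arcs_ends_conv)
    then have "(x, y) \<in> (arcs_ends (G \<restriction> W))\<^sup>s" "(y, x) \<in> (arcs_ends (G \<restriction> W))\<^sup>s"
      by (auto simp: symcl_def)
    then show "x \<in> {x \<in> W. (a, x) \<in> ?R} \<longleftrightarrow> y \<in> {x \<in> W. (a, x) \<in> ?R}"
      using xy by (auto intro: rtrancl_on_into_rtrancl_on)
  qed
qed

lemma globally_rigid_framework_imp_connected:
  fixes p :: "'v \<Rightarrow> 'a::real_normed_vector" and w :: 'a
  assumes wf: "wf_digraph G" and w: "w \<noteq> 0" and ne: "verts G \<noteq> {}"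
    and rigid: "globally_rigid_framework G p"
  shows "Digraph_Component.connected (G \<restriction> verts G)"
proof (rule ccontr)
  assume "\<not> Digraph_Component.connected (G \<restriction> verts G)"
  then obtain A a b where A: "A \<subseteq> verts G" "a \<in> A" "b \<in> verts G" "b \<notin> A"
    and sep: "\<And>x y. (x, y) \<in> arcs_ends G \<Longrightarrow> x \<in> verts G \<Longrightarrow> y \<in> verts G \<Longrightarrow> x \<in> A \<longleftrightarrow> y \<in> A"
    using not_connected_induce_subgraphE[OF _ ne] by metis
  define d where "d = p a - p b"
  \<comment> \<open>Longer than \<open>2 * norm d\<close>, so the triangle inequality gives
    \<open>norm (d + t) > norm d\<close>.\<close>
  define t where "t = ((2 * norm d + 1) / norm w) *\<^sub>R w"
  have t: "norm t = 2 * norm d + 1" using w by (simp add: t_def)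
  have "norm ((p a + t) - p b) = norm (p a - p b)"
    using globally_rigid_framework_dist[OF rigid, of "\<lambda>v. if v \<in> A then p v + t else p v" a b] sep wf A
    by fastforce
  then have "norm (d + t) = norm d" by (simp add: d_def algebra_simps)
  moreover have "norm t - norm d \<le> norm (d + t)"
    by (metis add.commute norm_diff_ineq)
  ultimately show False using t norm_ge_zero[of d] by linarith
qed

lemma globally_rigid_imp_no_cut_vertex:
  fixes G :: "('v, 'e) pre_digraph" and w :: "'a::real_normed_vector"
  assumes wf: "wf_digraph G" and fin: "finite (verts G)" and w: "w \<noteq> 0"
    and v: "v \<in> verts G" and ne: "verts G - {v} \<noteq> {}"
    and rigid: "globally_rigid TYPE('a) G"
  shows "Digraph_Component.connected (G \<restriction> (verts G - {v}))"
proof (rule ccontr)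
  assume "\<not> Digraph_Component.connected (G \<restriction> (verts G - {v}))"
  then obtain A a b where A: "A \<subseteq> verts G - {v}" "a \<in> A" "b \<in> verts G - {v}" "b \<notin> A"
    and sep: "\<And>x y. (x, y) \<in> arcs_ends G \<Longrightarrow> x \<in> verts G - {v} \<Longrightarrow> y \<in> verts G - {v} \<Longrightarrow> x \<in> A \<longleftrightarrow> y \<in> A"
    using not_connected_induce_subgraphE[OF _ ne] by metis
  \<comment> \<open>Reflecting the part \<open>A\<close> in the cut vertex preserves all edge lengths.\<close>
  have reflect: "norm (p v + p v - p a - p b) = norm (p a - p b)"
    if "globally_rigid_framework G p" for p :: "'v \<Rightarrow> 'a"
  proof -
    \<comment> \<open>The reflection fixes \<open>p v\<close>, so edges between \<open>A\<close> and
      \<open>v\<close> keep their length although \<open>v\<close> lies outside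
      \<open>A\<close>.\<close>
    define f where "f u = (if u \<in> A then p v + p v - p u else p u)" for u
    have "norm (f a - f b) = norm (p a - p b)"
    proof (rule globally_rigid_framework_dist[OF that _ wf])
      fix x y assume xy: "(x, y) \<in> arcs_ends G" "x \<in> verts G" "y \<in> verts G"
      then show "norm (p x - p y) = norm (f x - f y)"
        using sep[OF xy(1)] A(1)
        by (cases "x = v"; cases "y = v") (auto simp: f_def norm_minus_commute algebra_simps)
    qed (use A in auto)
    then show ?thesis using A by (simp add: f_def)
  qed
  obtain p :: "'v \<Rightarrow> 'a" and e where p: "p \<in> placements G" and e: "e > 0"
    and near: "\<And>q. q \<in> placements G \<Longrightarrow> (\<And>u. u \<in> verts G \<Longrightarrow> dist (p u) (q u) < e) \<Longrightarrow>
      globally_rigid_framework G q"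
    using globally_rigidE[OF fin rigid] by metis
  define z where "z = p v + p v - p a - p b"
  \<comment> \<open>Moving \<open>p a\<close> and \<open>p b\<close> by the same vector keeps \<open>p a - p b\<close> but changes \<open>z\<close>.\<close>
  have const: "norm (z - 2 *\<^sub>R h) = norm (p a - p b)" if h: "norm h < e" for h
  proof -
    have "globally_rigid_framework G (p(a := p a + h, b := p b + h))"
    proof (rule near)
      show "p(a := p a + h, b := p b + h) \<in> placements G"
        using p A by (auto simp: placements_def PiE_iff extensional_def)
    qed (use h e in \<open>auto simp: dist_norm\<close>)
    from reflect[OF this] show ?thesis
      using A by (auto simp: z_def scaleR_2 algebra_simps split: if_splits)
  qed
  have eq: "norm (z - 2 *\<^sub>R h) = norm z" if "norm h < e" for h
    using const[OF that] const[of 0] e by simp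
  show False
  proof (cases "z = 0")
    case True
    then show ?thesis using eq[of "(e / 2 / norm w) *\<^sub>R w"] w e by simp
  next
    case False
    \<comment> \<open>Shifting along \<open>z\<close> scales it by \<open>1 - 2 * k\<close>: the
      first bound keeps this factor nonnegative, the second keeps the shift shorter than
      \<open>e\<close>.\<close>
    define k where "k = min (1 / 2) (e / (2 * norm z))"
    have k: "k > 0" "k \<le> 1 / 2" using e False by (auto simp: k_def)
    have "k * norm z \<le> e / (2 * norm z) * norm z"
      by (intro mult_right_mono) (auto simp: k_def)
    then have "norm (k *\<^sub>R z) < e" using e False k by simp
    from eq[OF this] have "norm ((1 - 2 * k) *\<^sub>R z) = norm z"
      by (simp add: algebra_simps)
    then show False using k False by simp
  qed
qed

section \<open>Graphs with two vertices\<close>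

lemma globally_rigid_two_vertices_imp_parallelogram_law:
  fixes G :: "('v, 'e) pre_digraph" and B :: "'a::real_normed_vector set" and w :: 'a
  assumes basis: "finite B" "independent B" "span B = UNIV"
    and wf: "wf_digraph G" and w: "w \<noteq> 0" and card2: "card (verts G) = 2"
    and rigid: "globally_rigid TYPE('a) G"
  shows "parallelogram_law (norm :: 'a \<Rightarrow> real)"
proof -
  obtain a b where ab: "verts G = {a, b}" "a \<noteq> b"
    using card2 by (auto simp: card_2_iff)
  obtain p :: "'v \<Rightarrow> 'a" and e where p: "p \<in> placements G" and e: "e > 0"
    and near: "\<And>q. q \<in> placements G \<Longrightarrow> (\<And>u. u \<in> verts G \<Longrightarrow> dist (p u) (q u) < e) \<Longrightarrow>
      globally_rigid_framework G q"
    using globally_rigidE[OF _ rigid] ab by (metis finite.emptyI finite.insertI)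
  \<comment> \<open>Openness allows separating the two points if they coincide.\<close>
  obtain q :: "'v \<Rightarrow> 'a" where q: "globally_rigid_framework G q" "q a \<noteq> q b"
  proof (cases "p a = p b")
    case True
    define h where "h = (e / 2 / norm w) *\<^sub>R w"
    have h: "norm h < e" "h \<noteq> 0" using w e by (simp_all add: h_def)
    have "globally_rigid_framework G (p(a := p a + h))"
    proof (rule near)
      show "p(a := p a + h) \<in> placements G"
        using p ab by (auto simp: placements_def PiE_iff extensional_def)
    qed (use h e in \<open>auto simp: dist_norm\<close>)
    then show ?thesis using that[of "p(a := p a + h)"] True h ab by auto
  next
    case False
    then show ?thesis using that[of p] near[OF p] e by auto
  qed
  define u where "u = q a - q b"
  show ?thesis
  proof (rule transitive_imp_parallelogram_law[OF basis])
    show "u \<noteq> 0" using q by (simp add: u_def)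
    fix y :: 'a assume y: "norm y = norm u"
    define f where "f v = (if v = a then y else 0)" for v :: 'v
    obtain g where g: "isometry g" and fg: "\<And>v. v \<in> verts G \<Longrightarrow> f v = g (q v)"
    proof (rule globally_rigid_frameworkD[OF q(1) _ wf])
      fix x z assume "x \<in> verts G" "z \<in> verts G"
      then show "norm (q x - q z) = norm (f x - f z)"
        using ab y by (auto simp: f_def u_def norm_minus_commute)
    qed blast
    \<comment> \<open>Translating by \<open>q b\<close> makes \<open>h\<close> fix 0, the new
      position of \<open>b\<close>, and send \<open>u\<close> to \<open>y\<close>.\<close>
    define h where "h x = g (x + q b)" for x
    have h: "isometry h" using g by (simp add: h_def isometry_def)
    have h0: "h 0 = 0" and hu: "h u = y"
      using fg[of a] fg[of b] ab by (auto simp: h_def u_def f_def)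
    have surj: "surj h" by (rule isometry_surj[OF compact_cball_finite_dim[OF basis] h])
    moreover have "norm (h x) = norm x" for x
      using h h0 unfolding isometry_def by (metis dist_0_norm dist_commute)
    ultimately have "h \<in> linear_isometries"
      using Mazur_Ulam[OF h surj h0] by (simp add: linear_isometries_def)
    then show "\<exists>g\<in>linear_isometries. g u = y" using hu by blast
  qed
qed

theorem theorem3p1:
  fixes G :: "('v, 'e) pre_digraph"
  assumes finite_dim: "\<exists>B. finite_dimensional_vector_space ((*\<^sub>R) :: real \<Rightarrow> 'a \<Rightarrow> 'a) B"
    and non_euclidean: "\<not> parallelogram_law (norm :: 'a::real_normed_vector \<Rightarrow> real)"
    and simple_graph: "graph G"
    and card_verts: "card (verts G) \<ge> 2"
    and rigid: "globally_rigid TYPE('a) G"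
  shows "k_connected 2 G"
proof -
  interpret graph G by fact
  have wf: "wf_digraph G" ..
  obtain B :: "'a set" where B: "finite_dimensional_vector_space (*\<^sub>R) B"
    using finite_dim by blast
  have basis: "finite B" "independent B" "span B = UNIV"
    using finite_dimensional_vector_space.finite_Basis[OF B]
      finite_dimensional_vector_space.independent_Basis[OF B]
      finite_dimensional_vector_space.span_Basis[OF B]
    by (simp_all add: dependent_raw_def span_raw_def)
  \<comment> \<open>In the zero space the parallelogram law would hold trivially.\<close>
  obtain w :: 'a where w: "w \<noteq> 0"
    using non_euclidean unfolding parallelogram_law_def
    by (metis add.right_neutral diff_zero mult_zero_right norm_zero power_zero_numeral)
  have "card (verts G) \<noteq> 2"
    using globally_rigid_two_vertices_imp_parallelogram_law[OF basis wf w _ rigid] non_euclidean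
    by blast
  with card_verts have card3: "card (verts G) > 2" by simp
  moreover have "Digraph_Component.connected (G \<restriction> (verts G - S))"
    if S: "S \<subseteq> verts G" "card S < 2" for S
  proof (cases "S = {}")
    case True
    obtain p :: "'v \<Rightarrow> 'a" and e where "p \<in> placements G" "e > 0"
      "\<And>q. q \<in> placements G \<Longrightarrow> (\<And>u. u \<in> verts G \<Longrightarrow> dist (p u) (q u) < e) \<Longrightarrow>
        globally_rigid_framework G q"
      using globally_rigidE[OF finite_verts rigid] by metis
    then have "globally_rigid_framework G p" by simp
    moreover have "verts G \<noteq> {}" using card3 by auto
    ultimately show ?thesis
      using True globally_rigid_framework_imp_connected[OF wf w] by simp
  next
    case False
    have "finite S" using S(1) finite_subset finite_verts by blast
    with False S(2) have "card S = 1" by (metis One_nat_def card_gt_0_iff less_2_cases not_less0)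
    then obtain v where v: "S = {v}" by (auto simp: card_1_singleton_iff)
    have "verts G - {v} \<noteq> {}"
    proof
      assume "verts G - {v} = {}"
      then have "card (verts G) \<le> card {v}" by (intro card_mono) auto
      then show False using card3 by simp
    qed
    then show ?thesis
      using globally_rigid_imp_no_cut_vertex[OF wf finite_verts w _ _ rigid] S(1) v by simp
  qed
  ultimately show ?thesis unfolding k_connected_def by blast
qed

end
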